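(* For every positive integer $n$ there exists a bijection $\phi : DC(n) \rightarrow \mathfrak{D}_{n+1}'$ such that $$st(\phi(C)) = \binom{n}{2} - \mathrm{inv}(C)$$ for all $C \in DC(n)$.
   Context: Dellac configurations. A Dellac configuration of size $n$ is a placement of $2n$ dots in the cells of a grid with $n$ columns (indexed $1,\dots,n$ from left to right) and $2n$ rows (indexed $1,\dots,2n$ from bottom to top) such that each row contains exactly one dot, each column contains exactly two dots, and every dot lying in column $j$ and row $i$ satisfies $j \le i \le j+n$ (i.e. the dots lie between the lines $y=x$ and $y=x+n$). Let $DC(n)$ be the set of these. An inversion of $C\in DC(n)$ is a pair of dots with (column,row) coordinates $(j_1,i_1)$ and $(j_2,i_2)$ such that $j_1<j_2$ and $i_1>i_2$; $\mathrm{inv}(C)$ is the number of inversions. Dumont permutations. $\mathfrak{S}_m$ is the set of permutations of $[m]=\{1,\dots,m\}$. A Dumont permutation of order $2m$ is $\sigma\in\mathfrak{S}_{2m}$ with $\sigma(2i)<2i$ and $\sigma(2i-1)>2i-1$ for all $i\in[m]$; $\mathfrak{D}_m$ denotes their set. A normalized Dumont permutation of order $2m$ is $\sigma\in\mathfrak{D}_m$ such that for every $j\in[m-1]$, the integers $\sigma^{-1}(2j)$ and $\sigma^{-1}(2j+1)$ have the same parity if and only if $\sigma^{-1}(2j)>\sigma^{-1}(2j+1)$; $\mathfrak{D}_m'$ denotes their set. For a word $w=l_1\cdots l_r$ of integers, $\mathrm{inv}(w)$ is the number of pairs $a<b$ with $l_a>l_b$. For $\sigma\in\mathfrak{D}_m$,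 let $\sigma^o=\sigma(1)\sigma(3)\cdots\sigma(2m-1)$, $\sigma^e=\sigma(2)\sigma(4)\cdots\sigma(2m)$ and $$st(\sigma)=m^2-\sum_{i=1}^m\sigma(2i)-\mathrm{inv}(\sigma^o)-\mathrm{inv}(\sigma^e).$$ *)

theory Defs
  imports "HOL-Combinatorics.Permutations"
begin

(* Dots are pairs (column, row). *)
definition dellac_configs :: "nat \<Rightarrow> (nat \<times> nat) set set" where
  "dellac_configs n =
    {C. C \<subseteq> {1..n} \<times> {1..2 * n} \<and>
        (\<forall>i\<in>{1..2 * n}. card {j. (j, i) \<in> C} = 1) \<and>
        (\<forall>j\<in>{1..n}. card {i. (j, i) \<in> C} = 2) \<and>
        (\<forall>(j, i)\<in>C. j \<le> i \<and> i \<le> j + n)}"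

(* The condition orients each inversion, so ordered pairs count every inversion exactly once. *)
definition dellac_inv :: "(nat \<times> nat) set \<Rightarrow> nat" where
  "dellac_inv C = card {((j1, i1), (j2, i2)). (j1, i1) \<in> C \<and> (j2, i2) \<in> C \<and> j1 < j2 \<and> i1 > i2}"

definition dumont_perms :: "nat \<Rightarrow> (nat \<Rightarrow> nat) set" where
  "dumont_perms m =
    {\<sigma>. \<sigma> permutes {1..2 * m} \<and>
        (\<forall>i\<in>{1..m}. \<sigma> (2 * i) < 2 * i \<and> \<sigma> (2 * i - 1) > 2 * i - 1)}"

definition normalized_dumont_perms :: "nat \<Rightarrow> (nat \<Rightarrow> nat) set" where
  "normalized_dumont_perms m =
    {\<sigma> \<in> dumont_perms m. \<forall>j\<in>{1..m - 1}.
        (even (inv \<sigma> (2 * j)) \<longleftrightarrow> even (inv \<sigma> (2 * j + 1))) \<longleftrightarrow>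
        inv \<sigma> (2 * j) > inv \<sigma> (2 * j + 1)}"

definition word_inv :: "nat list \<Rightarrow> nat" where
  "word_inv w = card {(a, b). a < b \<and> b < length w \<and> w ! a > w ! b}"

definition odd_word :: "nat \<Rightarrow> (nat \<Rightarrow> nat) \<Rightarrow> nat list" where
  "odd_word m \<sigma> = map (\<lambda>i. \<sigma> (2 * i - 1)) [1..<m + 1]"

definition even_word :: "nat \<Rightarrow> (nat \<Rightarrow> nat) \<Rightarrow> nat list" where
  "even_word m \<sigma> = map (\<lambda>i. \<sigma> (2 * i)) [1..<m + 1]"

(* Integer-valued to avoid truncated subtraction. *)
definition dumont_st :: "nat \<Rightarrow> (nat \<Rightarrow> nat) \<Rightarrow> int" where
  "dumont_st m \<sigma> =
    int m ^ 2 - (\<Sum>i=1..m. int (\<sigma> (2 * i)))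
      - int (word_inv (odd_word m \<sigma>)) - int (word_inv (even_word m \<sigma>))"

end

theory Submission
  imports Defs
begin

text \<open>
  A Dumont permutation of order 2n + 2 maps 2 to 1 and 2n + 1 to 2n + 2.  Identify the position
  2i + 2 with row i and the position 2i - 1 with row n + i, and the pair of values 2j, 2j + 1 with
  column j.  The inequalities defining Dumont permutations then become the inequalities defining
  Dellac configurations, and the normalization condition says that in each column the lower dot
  carries the value 2j + 1 and the upper dot the value 2j.  Hence a normalized permutation is
  determined by its configuration.

  Call rows up to n low and the others high.  The inversions of the even and odd words are the
  inversions of the configuration between two low or two high rows, plus one for each
  column whose two dots are both low or both high.  The inversions between a low and a high
  row are counted by observing that exactly 2(j - 1) dots lie to the left of column j.
\<close>

section \<open>Rows of the grid and positions of the permutation\<close>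

definition row_position :: "nat \<Rightarrow> nat \<Rightarrow> nat" where
  "row_position n i = (if i \<le> n then 2 * i + 2 else 2 * (i - n) - 1)"

text \<open>Inverse to \<open>row_position\<close> on the rows. The two positions with forced values
  fall just outside the rows: 2 goes to 0, and 2n + 1 goes to 2n + 1.\<close>

definition position_row :: "nat \<Rightarrow> nat \<Rightarrow> nat" where
  "position_row n p = (if even p then p div 2 - 1 else n + (p + 1) div 2)"

definition row_value :: "nat \<Rightarrow> (nat \<Rightarrow> nat) \<Rightarrow> nat \<Rightarrow> nat" where
  "row_value n \<sigma> i = \<sigma> (row_position n i)"

definition row_column :: "nat \<Rightarrow> (nat \<Rightarrow> nat) \<Rightarrow> nat \<Rightarrow> nat" where
  "row_column n \<sigma> i = row_value n \<sigma> i div 2"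

text \<open>Taking the configuration as the transposed graph of a column function builds in the
  condition of one dot per row.\<close>

definition dellac_of :: "nat \<Rightarrow> (nat \<Rightarrow> nat) \<Rightarrow> (nat \<times> nat) set" where
  "dellac_of n \<sigma> = (\<lambda>i. (row_column n \<sigma> i, i)) ` {1..2 * n}"

lemma parity_of_less_same_half: "a div 2 = b div 2 \<Longrightarrow> a < b \<Longrightarrow> even a \<and> odd b" for a b :: nat
  by presburger

lemma eq_of_same_half_same_parity:
  "a div 2 = b div 2 \<Longrightarrow> even a \<longleftrightarrow> even b \<Longrightarrow> a = b" for a b :: nat
  by presburger

lemma position_row_row_position:
  "i \<in> {1..2 * n} \<Longrightarrow> position_row n (row_position n i) = i"
  by (auto simp: position_row_def row_position_def; presburger)

lemma row_position_position_row:
  "p \<in> {1..2 * n + 2} - {2, 2 * n + 1} \<Longrightarrow> row_position n (position_row n p) = p"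
  by (auto simp: position_row_def row_position_def elim!: evenE oddE)

lemma row_position_mem:
  "i \<in> {1..2 * n} \<Longrightarrow> row_position n i \<in> {1..2 * n + 2} - {2, 2 * n + 1}"
  by (auto simp: row_position_def; presburger)

lemma position_row_mem:
  "p \<in> {1..2 * n + 2} - {2, 2 * n + 1} \<Longrightarrow> position_row n p \<in> {1..2 * n}"
  by (auto simp: position_row_def elim!: evenE oddE)

lemma bij_betw_row_position:
  "bij_betw (row_position n) {1..2 * n} ({1..2 * n + 2} - {2, 2 * n + 1})"
  by (rule bij_betw_byWitness[where f' = "position_row n"])
    (intro ballI image_subsetI position_row_row_position row_position_position_row
      row_position_mem position_row_mem; assumption)+

section \<open>Counting pairs of indices\<close>

lemma card_pairs_less: "card {(i, k). 1 \<le> i \<and> i < k \<and> k \<le> n} = n choose 2" for n :: nat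
proof (induction n)
  case 0
  have "{(i, k). 1 \<le> i \<and> i < k \<and> k \<le> (0::nat)} = {}" by auto
  then show ?case by (simp only: card.empty binomial_0_Suc numeral_2_eq_2)
next
  case (Suc n)
  have fin: "finite {(i, k). 1 \<le> i \<and> i < k \<and> k \<le> n}"
    by (rule finite_subset[of _ "{..n} \<times> {..n}"]) auto
  have "{(i, k). 1 \<le> i \<and> i < k \<and> k \<le> Suc n} =
      {(i, k). 1 \<le> i \<and> i < k \<and> k \<le> n} \<union> {1..n} \<times> {Suc n}"
    by auto
  also have "card \<dots> = card {(i, k). 1 \<le> i \<and> i < k \<and> k \<le> n} + card ({1..n} \<times> {Suc n})"
    by (rule card_Un_disjoint) (use fin in auto)
  also have "\<dots> = Suc n choose 2"
    using Suc by (simp add: numeral_2_eq_2)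
  finally show ?case .
qed

text \<open>Every pair of distinct indices is counted once: in the sum, under the index with the
  larger value of \<open>f\<close>, or as a tie.\<close>

lemma card_strict_pairs_add_card_ties:
  fixes f :: "nat \<Rightarrow> nat"
  shows "(\<Sum>i=1..n. card {k \<in> {1..n}. f k < f i})
    + card {(i, k). 1 \<le> i \<and> i < k \<and> k \<le> n \<and> f k = f i} = n choose 2"
proof -
  let ?T = "{(i, k). 1 \<le> i \<and> i < k \<and> k \<le> n \<and> f k = f i}"
  let ?A = "{(i, k). 1 \<le> i \<and> i < k \<and> k \<le> n \<and> f k < f i}"
  let ?B = "{(i, k). 1 \<le> i \<and> i < k \<and> k \<le> n \<and> f i < f k}"
  have fin: "finite ?T" "finite ?A" "finite ?B"
    by (rule finite_subset[of _ "{..n} \<times> {..n}"]; auto)+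
  have "(\<Sum>i=1..n. card {k \<in> {1..n}. f k < f i}) =
      card (SIGMA i:{1..n}. {k \<in> {1..n}. f k < f i})"
    by (subst card_SigmaI) auto
  \<comment> \<open>The pairs with i < k are the inversions of \<open>f\<close>; those with k < i
    are the strict non-inversions with their entries swapped.\<close>
  also have "(SIGMA i:{1..n}. {k \<in> {1..n}. f k < f i}) = ?A \<union> prod.swap ` ?B"
  proof (intro set_eqI iffI)
    fix x assume "x \<in> (SIGMA i:{1..n}. {k \<in> {1..n}. f k < f i})"
    then obtain i k where x: "x = (i, k)" "1 \<le> i" "i \<le> n" "1 \<le> k" "k \<le> n" "f k < f i"
      by auto
    then have "i \<noteq> k" by auto
    then show "x \<in> ?A \<union> prod.swap ` ?B"
      using x by (cases "i < k") (auto simp: image_iff)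
  qed auto
  also have "card \<dots> = card ?A + card (prod.swap ` ?B)"
    by (rule card_Un_disjoint) (use fin in auto)
  also have "card (prod.swap ` ?B) = card ?B"
    by (rule card_image) auto
  finally have "(\<Sum>i=1..n. card {k \<in> {1..n}. f k < f i}) + card ?T
      = card ?A + card ?B + card ?T" by simp
  also have "\<dots> = card ((?A \<union> ?B) \<union> ?T)"
    using fin by (subst card_Un_disjoint; (subst card_Un_disjoint)?; auto)
  also have "(?A \<union> ?B) \<union> ?T = {(i, k). 1 \<le> i \<and> i < k \<and> k \<le> n}"
    by auto
  finally show ?thesis by (simp only: card_pairs_less)
qed

text \<open>Shifting both indices by one passes from list positions, which start at 0, to the
  indices of the words, which start at 1.\<close>

lemma word_inv_map_upt:
  "word_inv (map f [1..<m + 1]) = card {(a, b). 1 \<le> a \<and> a < b \<and> b \<le> m \<and> f b < f a}"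
proof -
  have "bij_betw (\<lambda>(a, b). (Suc a, Suc b))
      {(a, b). a < b \<and> b < m \<and> f (Suc b) < f (Suc a)}
      {(a, b). 1 \<le> a \<and> a < b \<and> b \<le> m \<and> f b < f a}"
    by (rule bij_betw_byWitness[where f' = "\<lambda>(a, b). (a - 1, b - 1)"]) auto
  moreover have "{(a, b). a < b \<and> b < length (map f [1..<m + 1]) \<and>
      map f [1..<m + 1] ! b < map f [1..<m + 1] ! a} =
      {(a, b). a < b \<and> b < m \<and> f (Suc b) < f (Suc a)}"
    by (auto simp: nth_append simp del: upt_Suc)
  ultimately show ?thesis
    unfolding word_inv_def by (simp only: bij_betw_same_card)
qed

section \<open>From a normalized Dumont permutation to a configuration\<close>

locale normalized_dumont =
  fixes n :: nat and \<sigma> :: "nat \<Rightarrow> nat"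
  assumes normalized: "\<sigma> \<in> normalized_dumont_perms (n + 1)"
begin

abbreviation "val \<equiv> row_value n \<sigma>"
abbreviation "col \<equiv> row_column n \<sigma>"

lemma permutes: "\<sigma> permutes {1..2 * n + 2}"
  using normalized by (simp add: normalized_dumont_perms_def dumont_perms_def)

lemma even_less: "i \<in> {1..n + 1} \<Longrightarrow> \<sigma> (2 * i) < 2 * i"
  and odd_greater: "i \<in> {1..n + 1} \<Longrightarrow> 2 * i - 1 < \<sigma> (2 * i - 1)"
  using normalized by (auto simp: normalized_dumont_perms_def dumont_perms_def)

lemma value_mem: "p \<in> {1..2 * n + 2} \<Longrightarrow> \<sigma> p \<in> {1..2 * n + 2}"
  using permutes_in_image[OF permutes] by blast

lemma two: "\<sigma> 2 = 1"
  using even_less[of 1] value_mem[of 2] by simp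

lemma last_odd: "\<sigma> (2 * n + 1) = 2 * n + 2"
  using odd_greater[of "n + 1"] value_mem[of "2 * n + 1"] by simp

text \<open>Deleting the positions 2 and 2n + 1 deletes exactly the values 1 and 2n + 2. The values
  left over split into the pairs 2j, 2j + 1 with 1 \<le> j \<le> n, one pair for each
  column.\<close>

lemma bij_betw_val: "bij_betw val {1..2 * n} {2..2 * n + 1}"
proof -
  have inj: "inj_on \<sigma> {1..2 * n + 2}"
    using permutes by (simp add: permutes_inj_on)
  have "\<sigma> ` ({1..2 * n + 2} - {2, 2 * n + 1}) = {1..2 * n + 2} - {1, 2 * n + 2}"
    using inj_on_image_set_diff[OF inj, of "{1..2 * n + 2}" "{2, 2 * n + 1}"]
      permutes_image[OF permutes] two last_odd by auto
  also have "\<dots> = {2..2 * n + 1}" by auto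
  finally have "bij_betw \<sigma> ({1..2 * n + 2} - {2, 2 * n + 1}) {2..2 * n + 1}"
    using inj by (auto simp: bij_betw_def intro: inj_on_subset)
  from bij_betw_trans[OF bij_betw_row_position this] show ?thesis
    by (simp add: comp_def row_value_def[abs_def])
qed

lemma val_mem: "i \<in> {1..2 * n} \<Longrightarrow> val i \<in> {2..2 * n + 1}"
  using bij_betw_val by (rule bij_betw_apply)

lemma col_mem: "i \<in> {1..2 * n} \<Longrightarrow> col i \<in> {1..n}"
  using val_mem[of i] by (auto simp: row_column_def)

lemma val_inj: "i \<in> {1..2 * n} \<Longrightarrow> k \<in> {1..2 * n} \<Longrightarrow> val i = val k \<Longrightarrow> i = k"
  using bij_betw_imp_inj_on[OF bij_betw_val] by (blast dest: inj_onD)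

lemma val_surj: "v \<in> {2..2 * n + 1} \<Longrightarrow> \<exists>i\<in>{1..2 * n}. val i = v"
  using bij_betw_imp_surj_on[OF bij_betw_val] by (metis imageE)

text \<open>For a low row, \<open>even_less\<close> gives \<open>col i \<le> i\<close>; for a high
  row, \<open>odd_greater\<close> gives \<open>i \<le> col i + n\<close>. In each case the other
  bound follows from 1 \<le> \<open>col i\<close> \<le> n.\<close>

lemma col_le: "i \<in> {1..2 * n} \<Longrightarrow> col i \<le> i"
  and le_col: "i \<in> {1..2 * n} \<Longrightarrow> i \<le> col i + n"
proof -
  assume i: "i \<in> {1..2 * n}"
  have low: "col i \<le> i" if "i \<le> n"
    using even_less[of "i + 1"] i that by (auto simp: row_column_def row_value_def row_position_def)
  have high: "i \<le> col i + n" if "n < i"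
  proof -
    have "i - n \<in> {1..n + 1}" using i that by auto
    then have "2 * (i - n) - 1 < val i"
      using odd_greater that by (simp add: row_value_def row_position_def)
    then show ?thesis using that unfolding row_column_def by linarith
  qed
  show "col i \<le> i" "i \<le> col i + n"
    using low high col_mem[OF i] by (cases "i \<le> n"; auto)+
qed

text \<open>This is where normalization enters. It excludes the assignment of 2j to the lower dot
  and 2j + 1 to the upper dot of column j.\<close>

lemma val_less_same_col:
  assumes i: "i \<in> {1..2 * n}" and k: "k \<in> {1..2 * n}" and "i < k" and eq: "col i = col k"
  shows "val k < val i"
proof (rule ccontr)
  assume "\<not> val k < val i"
  moreover have "val i \<noteq> val k" using val_inj[OF i k] \<open>i < k\<close> by auto
  ultimately have lt: "val i < val k" by simp
  define j where "j = col i"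
  have j: "j \<in> {1..n}" using col_mem[OF i] by (simp add: j_def)
  have vi: "\<sigma> (row_position n i) = 2 * j" and vk: "\<sigma> (row_position n k) = 2 * j + 1"
    using lt eq unfolding j_def row_column_def row_value_def by presburger+
  have "inv \<sigma> (2 * j) = row_position n i" "inv \<sigma> (2 * j + 1) = row_position n k"
    using vi vk permutes_inv_eq[OF permutes] by auto
  moreover have "(even (inv \<sigma> (2 * j)) \<longleftrightarrow> even (inv \<sigma> (2 * j + 1))) \<longleftrightarrow>
      inv \<sigma> (2 * j + 1) < inv \<sigma> (2 * j)"
    using normalized j by (auto simp: normalized_dumont_perms_def)
  ultimately have *: "(even (row_position n i) \<longleftrightarrow> even (row_position n k)) \<longleftrightarrow>
      row_position n k < row_position n i" by simp
  \<comment> \<open>If both rows are on the same side, the positions have equal parity and increase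
    with the row. Otherwise i is low and k is high, and these bounds give 2(k - n) - 1 \<le> 2j - 1
    < 2i + 2, so the positions differ in parity and are reversed. Both cases contradict
    \<open>*\<close>.\<close>
  have "j \<le> i" "k \<le> j + n"
    using col_le[OF i] le_col[OF k] eq by (auto simp: j_def)
  then show False
    using * i k \<open>i < k\<close> by (auto simp: row_position_def split: if_splits)
qed

text \<open>Different columns compare as their values do, and within a column the values decrease
  upwards; hence ties count as inversions of values.\<close>

lemma val_less_iff:
  assumes "i \<in> {1..2 * n}" "k \<in> {1..2 * n}" "i < k"
  shows "val k < val i \<longleftrightarrow> col k \<le> col i"
proof (cases "col k = col i")
  case True
  then show ?thesis using val_less_same_col[OF assms] by simp
next
  case False
  then show ?thesis unfolding row_column_def by presburger
qed

text \<open>Both 2j and 2j + 1 occur in column j, and the lower dot has the larger one, so an odd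
  value marks the dot with its partner above it.\<close>

lemma odd_val_iff:
  assumes i: "i \<in> {1..2 * n}"
  shows "odd (val i) \<longleftrightarrow> (\<exists>k\<in>{1..2 * n}. i < k \<and> col k = col i)"
proof
  assume "odd (val i)"
  then have v: "val i = 2 * col i + 1" by (simp add: row_column_def)
  have "2 * col i \<in> {2..2 * n + 1}" using col_mem[OF i] by auto
  then obtain k where k: "k \<in> {1..2 * n}" "val k = 2 * col i"
    using val_surj by blast
  then have "col k = col i" by (simp add: row_column_def)
  moreover have "\<not> k < i"
    using val_less_same_col[OF k(1) i _ \<open>col k = col i\<close>] v k(2) by linarith
  moreover have "i \<noteq> k" using v k(2) by auto
  ultimately show "\<exists>k\<in>{1..2 * n}. i < k \<and> col k = col i"
    using k(1) by (meson linorder_neqE_nat)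
next
  assume "\<exists>k\<in>{1..2 * n}. i < k \<and> col k = col i"
  then obtain k where k: "k \<in> {1..2 * n}" "i < k" "col k = col i" by blast
  then have "val k < val i" using val_less_same_col[OF i k(1)] by simp
  with k(3) show "odd (val i)" using parity_of_less_same_half unfolding row_column_def by blast
qed

lemma even_val_iff:
  assumes i: "i \<in> {1..2 * n}"
  shows "even (val i) \<longleftrightarrow> (\<exists>k\<in>{1..2 * n}. k < i \<and> col k = col i)"
proof
  assume "even (val i)"
  then have v: "val i = 2 * col i" by (simp add: row_column_def)
  have "2 * col i + 1 \<in> {2..2 * n + 1}" using col_mem[OF i] by auto
  then obtain k where k: "k \<in> {1..2 * n}" "val k = 2 * col i + 1"
    using val_surj by blast
  then have "col k = col i" by (simp add: row_column_def)
  moreover have "\<not> i < k"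
    using val_less_same_col[OF i k(1) _ \<open>col k = col i\<close>[symmetric]] v k(2) by linarith
  moreover have "i \<noteq> k" using v k(2) by auto
  ultimately show "\<exists>k\<in>{1..2 * n}. k < i \<and> col k = col i"
    using k(1) by (meson linorder_neqE_nat)
next
  assume "\<exists>k\<in>{1..2 * n}. k < i \<and> col k = col i"
  then obtain k where k: "k \<in> {1..2 * n}" "k < i" "col k = col i" by blast
  then have "val i < val k" using val_less_same_col[OF k(1) i] by simp
  with k(3) show "even (val i)"
    using parity_of_less_same_half unfolding row_column_def by metis
qed

text \<open>The values are recovered from the columns alone. This yields injectivity and dictates
  the inverse construction.\<close>

lemma val_eq:
  "i \<in> {1..2 * n} \<Longrightarrow>
    val i = 2 * col i + of_bool (\<exists>k\<in>{1..2 * n}. i < k \<and> col k = col i)"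
  using odd_val_iff[of i] by (auto simp: row_column_def)

lemma dellac_of_iff: "(j, i) \<in> dellac_of n \<sigma> \<longleftrightarrow> i \<in> {1..2 * n} \<and> j = col i"
  by (auto simp: dellac_of_def)

lemma dellac_of_mem: "dellac_of n \<sigma> \<in> dellac_configs n"
proof -
  have "card {j. (j, i) \<in> dellac_of n \<sigma>} = 1" if "i \<in> {1..2 * n}" for i
    using that by (simp add: dellac_of_iff)
  moreover have "card {i. (j, i) \<in> dellac_of n \<sigma>} = 2" if j: "j \<in> {1..n}" for j
  proof -
    \<comment> \<open>The two dots of column j are the rows that carry its two values.\<close>
    have "bij_betw val {i \<in> {1..2 * n}. j = col i} {2 * j, 2 * j + 1}"
      unfolding bij_betw_def
    proof
      show "inj_on val {i \<in> {1..2 * n}. j = col i}"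
        using val_inj by (auto simp: inj_on_def)
      show "val ` {i \<in> {1..2 * n}. j = col i} = {2 * j, 2 * j + 1}"
      proof
        show "val ` {i \<in> {1..2 * n}. j = col i} \<subseteq> {2 * j, 2 * j + 1}"
          by (auto simp: row_column_def; presburger)
        show "{2 * j, 2 * j + 1} \<subseteq> val ` {i \<in> {1..2 * n}. j = col i}"
        proof
          fix v assume v: "v \<in> {2 * j, 2 * j + 1}"
          with j have "v \<in> {2..2 * n + 1}" by auto
          then obtain i where "i \<in> {1..2 * n}" "val i = v"
            using val_surj by blast
          with v show "v \<in> val ` {i \<in> {1..2 * n}. j = col i}"
            by (auto simp: row_column_def image_iff)
        qed
      qed
    qed
    from bij_betw_same_card[OF this] show ?thesis
      by (simp add: dellac_of_iff)
  qed
  ultimately show ?thesis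
    using col_mem col_le le_col unfolding dellac_configs_def
    by (auto simp: dellac_of_def)
qed

section \<open>Ties and inversions between low and high rows\<close>

abbreviation "low_ties \<equiv> {(i, k). 1 \<le> i \<and> i < k \<and> k \<le> n \<and> col k = col i}"
abbreviation "high_ties \<equiv> {(i, k). n < i \<and> i < k \<and> k \<le> 2 * n \<and> col k = col i}"
text \<open>The lower row comes first in each pair, so an inversion has the larger column at its
  first entry.\<close>

abbreviation "low_invs \<equiv> {(i, k). 1 \<le> i \<and> i < k \<and> k \<le> n \<and> col k < col i}"
abbreviation "high_invs \<equiv> {(i, k). n < i \<and> i < k \<and> k \<le> 2 * n \<and> col k < col i}"
abbreviation "cross_invs \<equiv> {(i, k). 1 \<le> i \<and> i \<le> n \<and> n < k \<and> k \<le> 2 * n \<and> col k < col i}"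

lemma finite_pairs:
  "finite low_ties" "finite high_ties" "finite low_invs" "finite high_invs" "finite cross_invs"
  by (rule finite_subset[of _ "{..2 * n} \<times> {..2 * n}"]; auto)+

text \<open>Both lower rows would carry the odd value of the column.\<close>

lemma tie_below_unique:
  assumes "i \<in> {1..2 * n}" "i' \<in> {1..2 * n}" "k \<in> {1..2 * n}" "i < k" "i' < k"
    "col k = col i" "col k = col i'"
  shows "i = i'"
proof -
  have "odd (val i)" "odd (val i')"
    using odd_val_iff assms by blast+
  then have "val i = val i'"
    using assms(6,7) eq_of_same_half_same_parity unfolding row_column_def by metis
  then show ?thesis using val_inj assms(1,2) by blast
qed

lemma tie_above_unique:
  assumes "i \<in> {1..2 * n}" "k \<in> {1..2 * n}" "k' \<in> {1..2 * n}" "i < k" "i < k'"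
    "col k = col i" "col k' = col i"
  shows "k = k'"
proof -
  have "even (val k)" "even (val k')"
    using even_val_iff assms by metis+
  then have "val k = val k'"
    using assms(6,7) eq_of_same_half_same_parity unfolding row_column_def by metis
  then show ?thesis using val_inj assms(2,3) by blast
qed

text \<open>A tie is recorded by its upper row, which has an even value. Conversely, the partner of
  a low row with even value lies below it and is therefore low too.\<close>

lemma card_low_ties: "card low_ties = card {i \<in> {1..n}. even (val i)}"
proof -
  have inj: "inj_on snd low_ties"
  proof (rule inj_onI)
    fix x y assume "x \<in> low_ties" "y \<in> low_ties" "snd x = snd y"
    then obtain i i' k where "x = (i, k)" "y = (i', k)" "1 \<le> i" "i < k" "1 \<le> i'" "i' < k"
      "k \<le> n" "col k = col i" "col k = col i'" by auto
    then show "x = y" using tie_below_unique[of i i' k] by simp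
  qed
  have img: "snd ` low_ties = {i \<in> {1..n}. even (val i)}"
  proof (intro set_eqI iffI)
    fix k assume "k \<in> snd ` low_ties"
    then obtain i where ik: "1 \<le> i" "i < k" "k \<le> n" "col k = col i" by auto
    then have "i \<in> {1..2 * n}" "k \<in> {1..2 * n}" by auto
    then have "even (val k)" using even_val_iff ik by metis
    then show "k \<in> {i \<in> {1..n}. even (val i)}" using ik by simp
  next
    fix k assume k: "k \<in> {i \<in> {1..n}. even (val i)}"
    then have "k \<in> {1..2 * n}" "even (val k)" by auto
    then obtain i where "i \<in> {1..2 * n}" "i < k" "col i = col k" using even_val_iff by blast
    then have "(i, k) \<in> low_ties" using k by simp
    then show "k \<in> snd ` low_ties" by (rule image_eqI[rotated]) simp
  qed
  show ?thesis by (simp only: card_image[OF inj, symmetric] img)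
qed

text \<open>Dually, a tie is recorded by its lower row: the partner of a high row with odd value
  lies above it and stays high.\<close>

lemma card_high_ties: "card high_ties = card {i \<in> {n + 1..2 * n}. odd (val i)}"
proof -
  have inj: "inj_on fst high_ties"
  proof (rule inj_onI)
    fix x y assume "x \<in> high_ties" "y \<in> high_ties" "fst x = fst y"
    then obtain i k k' where "x = (i, k)" "y = (i, k')" "n < i" "i < k" "k \<le> 2 * n" "i < k'"
      "k' \<le> 2 * n" "col k = col i" "col k' = col i" by auto
    then show "x = y" using tie_above_unique[of i k k'] by simp
  qed
  have img: "fst ` high_ties = {i \<in> {n + 1..2 * n}. odd (val i)}"
  proof (intro set_eqI iffI)
    fix i assume "i \<in> fst ` high_ties"
    then obtain k where ik: "n < i" "i < k" "k \<le> 2 * n" "col k = col i" by auto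
    then have "i \<in> {1..2 * n}" "k \<in> {1..2 * n}" by auto
    then have "odd (val i)" using odd_val_iff ik by blast
    then show "i \<in> {i \<in> {n + 1..2 * n}. odd (val i)}" using ik by simp
  next
    fix i assume i: "i \<in> {i \<in> {n + 1..2 * n}. odd (val i)}"
    then have "i \<in> {1..2 * n}" "odd (val i)" by auto
    then obtain k where "k \<in> {1..2 * n}" "i < k" "col k = col i" using odd_val_iff by blast
    then have "(i, k) \<in> high_ties" using i by simp
    then show "i \<in> fst ` high_ties" by (rule image_eqI[rotated]) simp
  qed
  show ?thesis by (simp only: card_image[OF inj, symmetric] img)
qed

section \<open>Balance of ties, and cross inversions\<close>

lemma card_low_odd: "card {i \<in> {1..n}. odd (val i)} + card low_ties = n"
proof -
  have "card {i \<in> {1..n}. odd (val i)} + card {i \<in> {1..n}. even (val i)}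
      = card ({i \<in> {1..n}. odd (val i)} \<union> {i \<in> {1..n}. even (val i)})"
    by (subst card_Un_disjoint) auto
  also have "{i \<in> {1..n}. odd (val i)} \<union> {i \<in> {1..n}. even (val i)} = {1..n}" by auto
  finally show ?thesis unfolding card_low_ties by simp
qed

text \<open>There are n odd values in all. By \<open>card_low_odd\<close>, low rows carry n minus
  the number of low ties of them, and high rows carry one for each high tie.\<close>

lemma card_ties_eq: "card high_ties = card low_ties"
proof -
  have "bij_betw (\<lambda>j. 2 * j + 1) {1..n} {v \<in> {2..2 * n + 1}. odd v}"
    by (rule bij_betw_byWitness[where f' = "\<lambda>v. v div 2"]) (auto elim!: oddE)
  then have "n = card {v \<in> {2..2 * n + 1}. odd v}"
    using bij_betw_same_card by fastforce
  also have "{v \<in> {2..2 * n + 1}. odd v} = val ` {i \<in> {1..2 * n}. odd (val i)}"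
    unfolding bij_betw_imp_surj_on[OF bij_betw_val, symmetric] by blast
  also have "card \<dots> = card {i \<in> {1..2 * n}. odd (val i)}"
    by (rule card_image) (use val_inj in \<open>auto simp: inj_on_def\<close>)
  also have "{i \<in> {1..2 * n}. odd (val i)} =
      {i \<in> {1..n}. odd (val i)} \<union> {i \<in> {n + 1..2 * n}. odd (val i)}" by auto
  also have "card \<dots> = card {i \<in> {1..n}. odd (val i)} + card high_ties"
    unfolding card_high_ties by (rule card_Un_disjoint) auto
  finally show ?thesis using card_low_odd by simp
qed

lemma sum_low_val: "(\<Sum>i=1..n. val i) + card low_ties = 2 * (\<Sum>i=1..n. col i) + n"
proof -
  have "(\<Sum>i=1..n. val i) = (\<Sum>i=1..n. 2 * col i + of_bool (odd (val i)))"
    by (rule sum.cong) (auto simp: row_column_def)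
  also have "\<dots> = 2 * (\<Sum>i=1..n. col i) + card {i \<in> {1..n}. odd (val i)}"
    by (simp add: sum.distrib sum_distrib_left sum_of_bool_eq Int_def)
  finally show ?thesis using card_low_odd by simp
qed

text \<open>The columns to the left of j use exactly the values 2, ..., 2j - 1.\<close>

lemma card_col_less:
  assumes "j \<in> {1..n}"
  shows "card {k \<in> {1..2 * n}. col k < j} = 2 * j - 2"
proof -
  have "card {k \<in> {1..2 * n}. col k < j} = card (val ` {k \<in> {1..2 * n}. col k < j})"
    by (rule card_image[symmetric]) (use val_inj in \<open>auto simp: inj_on_def\<close>)
  also have "val ` {k \<in> {1..2 * n}. col k < j} = {v \<in> {2..2 * n + 1}. v div 2 < j}"
    unfolding bij_betw_imp_surj_on[OF bij_betw_val, symmetric] row_column_def by blast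
  also have "\<dots> = {2..<2 * j}" using assms by auto
  finally show ?thesis by simp
qed

text \<open>For a low row i, the 2(\<open>col i\<close> - 1) rows in columns further left are either
  high, which gives the cross inversions, or low. Summed over i, the low ones number
  \<open>n choose 2\<close> minus the low ties.\<close>

lemma card_cross_invs:
  "card cross_invs + (n choose 2) + 2 * n = 2 * (\<Sum>i=1..n. col i) + card low_ties"
proof -
  have split: "card {k \<in> {n + 1..2 * n}. col k < col i} + card {k \<in> {1..n}. col k < col i} + 2
      = 2 * col i" if "i \<in> {1..n}" for i
  proof -
    have "card {k \<in> {n + 1..2 * n}. col k < col i} + card {k \<in> {1..n}. col k < col i}
        = card ({k \<in> {n + 1..2 * n}. col k < col i} \<union> {k \<in> {1..n}. col k < col i})"
      by (rule card_Un_disjoint[symmetric]) auto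
    also have "{k \<in> {n + 1..2 * n}. col k < col i} \<union> {k \<in> {1..n}. col k < col i}
        = {k \<in> {1..2 * n}. col k < col i}" by auto
    finally show ?thesis using card_col_less[of "col i"] col_mem[of i] that by auto
  qed
  have "cross_invs = (SIGMA i:{1..n}. {k \<in> {n + 1..2 * n}. col k < col i})" by auto
  then have "card cross_invs = (\<Sum>i=1..n. card {k \<in> {n + 1..2 * n}. col k < col i})"
    by (simp only:) (subst card_SigmaI; auto)
  then have "card cross_invs + (\<Sum>i=1..n. card {k \<in> {1..n}. col k < col i}) + 2 * n
      = (\<Sum>i=1..n. card {k \<in> {n + 1..2 * n}. col k < col i} + card {k \<in> {1..n}. col k < col i} + 2)"
    by (simp only: sum.distrib) simp
  also have "\<dots> = 2 * (\<Sum>i=1..n. col i)"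
    using split by (simp add: sum_distrib_left)
  finally show ?thesis
    using card_strict_pairs_add_card_ties[of n col] by linarith
qed

section \<open>The inversion counts and the statistic\<close>

lemma dellac_inv_eq:
  "dellac_inv (dellac_of n \<sigma>) = card low_invs + card high_invs + card cross_invs"
proof -
  let ?I = "{((j1, i1), j2, i2). (j1, i1) \<in> dellac_of n \<sigma> \<and> (j2, i2) \<in> dellac_of n \<sigma> \<and>
      j1 < j2 \<and> i1 > i2}"
  \<comment> \<open>The rows determine the dots. In an inversion the second dot has the lower row,
    hence the swap.\<close>
  have "bij_betw (\<lambda>((j1, i1), (j2, i2)). (i2, i1)) ?I (low_invs \<union> high_invs \<union> cross_invs)"
    by (rule bij_betw_byWitness[where f' = "\<lambda>(i, k). ((col k, k), (col i, i))"])
      (auto simp: dellac_of_iff)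
  then have "dellac_inv (dellac_of n \<sigma>) = card (low_invs \<union> high_invs \<union> cross_invs)"
    unfolding dellac_inv_def by (rule bij_betw_same_card)
  also have "\<dots> = card (low_invs \<union> high_invs) + card cross_invs"
    by (rule card_Un_disjoint) (use finite_pairs in auto)
  also have "card (low_invs \<union> high_invs) = card low_invs + card high_invs"
    by (rule card_Un_disjoint) (use finite_pairs in auto)
  finally show ?thesis .
qed

text \<open>The last letter 2n + 2 is maximal and takes part in no inversion. The other letters are
  the values of the high rows in increasing order of row.\<close>

lemma word_inv_odd: "word_inv (odd_word (n + 1) \<sigma>) = card high_invs + card high_ties"
proof -
  have v: "\<sigma> (2 * a - 1) = val (a + n)" if "1 \<le> a" for a
    using that by (simp add: row_value_def row_position_def)
  have last: "\<sigma> (2 * a - 1) \<le> \<sigma> (2 * (n + 1) - 1)" if "1 \<le> a" "a \<le> n" for a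
  proof -
    have "2 * a - 1 \<in> {1..2 * n + 2}" using that by auto
    from value_mem[OF this] show ?thesis using last_odd by simp
  qed
  have less: "\<sigma> (2 * b - 1) < \<sigma> (2 * a - 1) \<longleftrightarrow> col (b + n) \<le> col (a + n)"
    if "1 \<le> a" "a < b" "b \<le> n" for a b
    using that val_less_iff[of "a + n" "b + n"] v[of a] v[of b] by simp
  have "{(a, b). 1 \<le> a \<and> a < b \<and> b \<le> n + 1 \<and> \<sigma> (2 * b - 1) < \<sigma> (2 * a - 1)}
      = {(a, b). 1 \<le> a \<and> a < b \<and> b \<le> n \<and> col (b + n) \<le> col (a + n)}"
  proof (intro set_eqI, clarify)
    fix a b
    show "(a, b) \<in> {(a, b). 1 \<le> a \<and> a < b \<and> b \<le> n + 1 \<and> \<sigma> (2 * b - 1) < \<sigma> (2 * a - 1)}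
      \<longleftrightarrow> (a, b) \<in> {(a, b). 1 \<le> a \<and> a < b \<and> b \<le> n \<and> col (b + n) \<le> col (a + n)}"
      using last[of a] less[of a b] by (cases "b = n + 1") auto
  qed
  then have "word_inv (odd_word (n + 1) \<sigma>) =
      card {(a, b). 1 \<le> a \<and> a < b \<and> b \<le> n \<and> col (b + n) \<le> col (a + n)}"
    unfolding odd_word_def word_inv_map_upt by simp
  also have "bij_betw (\<lambda>(a, b). (a + n, b + n))
      {(a, b). 1 \<le> a \<and> a < b \<and> b \<le> n \<and> col (b + n) \<le> col (a + n)} (high_invs \<union> high_ties)"
    by (rule bij_betw_byWitness[where f' = "\<lambda>(a, b). (a - n, b - n)"]) auto
  note bij_betw_same_card[OF this]
  also have "card (high_invs \<union> high_ties) = card high_invs + card high_ties"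
    by (rule card_Un_disjoint) (use finite_pairs in auto)
  finally show ?thesis .
qed

text \<open>The first letter 1 is minimal and takes part in no inversion. The other letters are the
  values of the low rows in increasing order of row.\<close>

lemma word_inv_even: "word_inv (even_word (n + 1) \<sigma>) = card low_invs + card low_ties"
proof -
  have v: "\<sigma> (2 * a) = val (a - 1)" if "2 \<le> a" "a \<le> n + 1" for a
  proof -
    have "2 * a = row_position n (a - 1)" using that by (auto simp: row_position_def)
    then show ?thesis by (simp add: row_value_def)
  qed
  have less: "\<sigma> (2 * b) < \<sigma> (2 * a) \<longleftrightarrow> col (b - 1) \<le> col (a - 1)"
    if "2 \<le> a" "a < b" "b \<le> n + 1" for a b
    using that val_less_iff[of "a - 1" "b - 1"] v[of a] v[of b] by simp
  have "{(a, b). 1 \<le> a \<and> a < b \<and> b \<le> n + 1 \<and> \<sigma> (2 * b) < \<sigma> (2 * a)}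
      = {(a, b). 2 \<le> a \<and> a < b \<and> b \<le> n + 1 \<and> col (b - 1) \<le> col (a - 1)}"
  proof (intro set_eqI, clarify)
    fix a b
    show "(a, b) \<in> {(a, b). 1 \<le> a \<and> a < b \<and> b \<le> n + 1 \<and> \<sigma> (2 * b) < \<sigma> (2 * a)}
      \<longleftrightarrow> (a, b) \<in> {(a, b). 2 \<le> a \<and> a < b \<and> b \<le> n + 1 \<and> col (b - 1) \<le> col (a - 1)}"
      using two value_mem[of "2 * b"] less[of a b] by (cases "a = 1") auto
  qed
  then have "word_inv (even_word (n + 1) \<sigma>) =
      card {(a, b). 2 \<le> a \<and> a < b \<and> b \<le> n + 1 \<and> col (b - 1) \<le> col (a - 1)}"
    unfolding even_word_def word_inv_map_upt by simp
  also have "bij_betw (\<lambda>(a, b). (a - 1, b - 1))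
      {(a, b). 2 \<le> a \<and> a < b \<and> b \<le> n + 1 \<and> col (b - 1) \<le> col (a - 1)} (low_invs \<union> low_ties)"
    by (rule bij_betw_byWitness[where f' = "\<lambda>(a, b). (a + 1, b + 1)"]) auto
  note bij_betw_same_card[OF this]
  also have "card (low_invs \<union> low_ties) = card low_invs + card low_ties"
    by (rule card_Un_disjoint) (use finite_pairs in auto)
  finally show ?thesis .
qed

lemma sum_even_positions: "(\<Sum>i=1..n + 1. \<sigma> (2 * i)) = 1 + (\<Sum>i=1..n. val i)"
proof -
  have "(\<Sum>i=1..n + 1. \<sigma> (2 * i)) = \<sigma> 2 + (\<Sum>i=Suc 1..n + 1. \<sigma> (2 * i))"
    by (subst sum.atLeast_Suc_atMost) auto
  also have "(\<Sum>i=Suc 1..n + 1. \<sigma> (2 * i)) = (\<Sum>i=1..n. \<sigma> (2 * Suc i))"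
    by (simp only: Suc_eq_plus1[symmetric] sum.shift_bounds_cl_Suc_ivl)
  also have "\<dots> = (\<Sum>i=1..n. val i)"
    by (rule sum.cong) (auto simp: row_value_def row_position_def)
  finally show ?thesis using two by simp
qed

text \<open>Let L and H be the numbers of low and high ties. Eliminating the column sum turns the
  sum of the low values into the cross inversions plus \<open>n choose 2\<close> + 3n - 2L. The ties
  then contribute L - H = 0 to the statistic, and n^2 - n = 2 \<open>(n choose 2)\<close> leaves the
  claim.\<close>

lemma dumont_st_eq:
  "dumont_st (n + 1) \<sigma> = int (n choose 2) - int (dellac_inv (dellac_of n \<sigma>))"
proof -
  have c: "2 * int (n choose 2) = int n ^ 2 - int n"
  proof -
    have "2 * (n choose 2) + n = n ^ 2"
      by (cases n) (auto simp: choose_two power2_eq_square)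
    then have "int (2 * (n choose 2) + n) = int (n ^ 2)" by simp
    then show ?thesis by simp
  qed
  have s: "(\<Sum>i=1..n + 1. int (\<sigma> (2 * i))) = 1 + int (\<Sum>i=1..n. val i)"
    using arg_cong[OF sum_even_positions, of int] by simp
  have q: "int (n + 1) ^ 2 = int n ^ 2 + 2 * int n + 1"
    by (simp add: power2_eq_square algebra_simps)
  show ?thesis
    unfolding dumont_st_def s q word_inv_odd word_inv_even dellac_inv_eq
    using c card_cross_invs sum_low_val card_ties_eq by linarith
qed

end

section \<open>Bijectivity of the correspondence\<close>

lemma dellac_of_inj: "inj_on (dellac_of n) (normalized_dumont_perms (n + 1))"
proof (rule inj_onI)
  fix \<sigma> \<tau>
  assume \<sigma>: "\<sigma> \<in> normalized_dumont_perms (n + 1)" and \<tau>: "\<tau> \<in> normalized_dumont_perms (n + 1)"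
    and eq: "dellac_of n \<sigma> = dellac_of n \<tau>"
  interpret s: normalized_dumont n \<sigma> by unfold_locales (fact \<sigma>)
  interpret t: normalized_dumont n \<tau> by unfold_locales (fact \<tau>)
  have col: "row_column n \<sigma> i = row_column n \<tau> i" if "i \<in> {1..2 * n}" for i
    using s.dellac_of_iff[of "row_column n \<sigma> i" i] t.dellac_of_iff[of "row_column n \<sigma> i" i] eq that
    by simp
  \<comment> \<open>Equal column functions give equal values at all rows; only the two forced
    positions and the fixed points outside the interval remain.\<close>
  have val: "row_value n \<sigma> i = row_value n \<tau> i" if "i \<in> {1..2 * n}" for i
    using that col s.val_eq[OF that] t.val_eq[OF that] by simp
  show "\<sigma> = \<tau>"
  proof
    fix p
    consider "p \<notin> {1..2 * n + 2}" | "p = 2" | "p = 2 * n + 1"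
      | "p \<in> {1..2 * n + 2} - {2, 2 * n + 1}" by blast
    then show "\<sigma> p = \<tau> p"
    proof cases
      case 1
      then show ?thesis using s.permutes t.permutes by (simp add: permutes_not_in)
    next
      case 4
      then show ?thesis
        using val[OF position_row_mem[OF 4]] by (simp add: row_value_def row_position_position_row)
    qed (use s.two t.two s.last_odd t.last_odd in auto)
  qed
qed

lemma dellac_of_surj:
  assumes C: "C \<in> dellac_configs n"
  shows "\<exists>\<sigma>\<in>normalized_dumont_perms (n + 1). dellac_of n \<sigma> = C"
proof -
  have sub: "C \<subseteq> {1..n} \<times> {1..2 * n}"
    and row: "\<And>i. i \<in> {1..2 * n} \<Longrightarrow> card {j. (j, i) \<in> C} = 1"
    and column: "\<And>j. j \<in> {1..n} \<Longrightarrow> card {i. (j, i) \<in> C} = 2"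
    and bound: "\<And>j i. (j, i) \<in> C \<Longrightarrow> j \<le> i \<and> i \<le> j + n"
    using C unfolding dellac_configs_def by auto
  define c where "c i = (THE j. (j, i) \<in> C)" for i
  have c: "(j, i) \<in> C \<longleftrightarrow> j = c i" if i: "i \<in> {1..2 * n}" for i j
  proof -
    obtain j0 where j0: "{j. (j, i) \<in> C} = {j0}"
      using row[OF i] by (auto simp: card_1_singleton_iff)
    then have "c i = j0" unfolding c_def by auto
    with j0 show ?thesis by auto
  qed
  have c_mem: "c i \<in> {1..n}" and c_le: "c i \<le> i" and le_c: "i \<le> c i + n" if "i \<in> {1..2 * n}" for i
  proof -
    have "(c i, i) \<in> C" using c[OF that] by simp
    then show "c i \<in> {1..n}" "c i \<le> i" "i \<le> c i + n" using sub bound by auto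
  qed
  have no_three: False
    if "i \<in> {1..2 * n}" "k \<in> {1..2 * n}" "l \<in> {1..2 * n}" "i < k" "k < l" "c i = c k" "c k = c l"
    for i k l
  proof -
    have "{i, k, l} \<subseteq> {r. (c i, r) \<in> C}" using that c by auto
    moreover have "finite {r. (c i, r) \<in> C}"
      using column[OF c_mem[OF that(1)]] by (metis card.infinite zero_neq_numeral)
    ultimately have "card {i, k, l} \<le> card {r. (c i, r) \<in> C}" by (rule card_mono[rotated])
    then show False using that column[OF c_mem[OF that(1)]] by simp
  qed
  \<comment> \<open>The formula of \<open>val_eq\<close>: in each column the lower dot receives the
    odd value and the upper dot the even one.\<close>
  define v where "v i = 2 * c i + of_bool (\<exists>k\<in>{1..2 * n}. i < k \<and> c k = c i)" for i
  have v_div: "v i div 2 = c i" for i by (simp add: v_def)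
  have v_decreasing: "v i = 2 * c i + 1 \<and> v k = 2 * c i"
    if "i \<in> {1..2 * n}" "k \<in> {1..2 * n}" "i < k" "c i = c k" for i k
  proof -
    have "\<exists>l\<in>{1..2 * n}. i < l \<and> c l = c i" using that by metis
    moreover have "\<not> (\<exists>l\<in>{1..2 * n}. k < l \<and> c l = c k)" using that no_three by metis
    ultimately show ?thesis using that(4) by (simp add: v_def)
  qed
  have v_inj: "i = k" if "i \<in> {1..2 * n}" "k \<in> {1..2 * n}" "v i = v k" for i k
  proof -
    have "c i = c k" using that(3) v_div by metis
    then show ?thesis
      using v_decreasing[OF that(1,2)] v_decreasing[OF that(2,1)] that(3)
      by (metis Suc_eq_plus1 linorder_neqE_nat n_not_Suc_n)
  qed
  have v_mem: "v i \<in> {2..2 * n + 1}" if "i \<in> {1..2 * n}" for i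
    using c_mem[OF that] by (auto simp: v_def)
  \<comment> \<open>Positions 2 and 2n + 1 receive the forced values, and points outside the
    interval are fixed, as \<open>permutes\<close> demands.\<close>
  define \<sigma> where "\<sigma> p = (if p \<notin> {1..2 * n + 2} then p else if p = 2 then 1
      else if p = 2 * n + 1 then 2 * n + 2 else v (position_row n p))" for p
  have \<sigma>_v: "\<sigma> p = v (position_row n p)" if "p \<in> {1..2 * n + 2} - {2, 2 * n + 1}" for p
    using that by (auto simp: \<sigma>_def)
  have \<sigma>_mem: "\<sigma> p \<in> {2..2 * n + 1}" if "p \<in> {1..2 * n + 2} - {2, 2 * n + 1}" for p
    using v_mem[OF position_row_mem[OF that]] \<sigma>_v[OF that] by simp
  have \<sigma>_ends: "\<sigma> 2 = 1" "\<sigma> (2 * n + 1) = 2 * n + 2" by (auto simp: \<sigma>_def)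
  have "inj_on \<sigma> ({1..2 * n + 2} - {2, 2 * n + 1})"
  proof (rule inj_onI)
    fix p q assume p: "p \<in> {1..2 * n + 2} - {2, 2 * n + 1}"
      and q: "q \<in> {1..2 * n + 2} - {2, 2 * n + 1}" and "\<sigma> p = \<sigma> q"
    then have "position_row n p = position_row n q"
      using v_inj[OF position_row_mem[OF p] position_row_mem[OF q]] \<sigma>_v by simp
    then show "p = q" using row_position_position_row p q by metis
  qed
  moreover have "\<sigma> ` ({1..2 * n + 2} - {2, 2 * n + 1}) \<subseteq> {2..2 * n + 1}"
    using \<sigma>_mem by blast
  \<comment> \<open>Injectivity extends to the two added positions because their values 1 and 2n + 2
    lie outside {2..2n + 1}.\<close>
  ultimately have "inj_on \<sigma> (insert 2 (insert (2 * n + 1) ({1..2 * n + 2} - {2, 2 * n + 1})))"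
    using \<sigma>_ends by (auto simp: inj_on_insert)
  moreover have "insert 2 (insert (2 * n + 1) ({1..2 * n + 2} - {2, 2 * n + 1})) = {1..2 * n + 2}"
    by auto
  ultimately have inj: "inj_on \<sigma> {1..2 * n + 2}" by (simp only:)
  have "\<sigma> p \<in> {1..2 * n + 2}" if "p \<in> {1..2 * n + 2}" for p
    using \<sigma>_mem[of p] \<sigma>_ends that by (cases "p \<in> {2, 2 * n + 1}") auto
  then have "\<sigma> ` {1..2 * n + 2} = {1..2 * n + 2}"
    using inj by (intro endo_inj_surj finite_atLeastAtMost image_subsetI)
  with inj have "bij_betw \<sigma> {1..2 * n + 2} {1..2 * n + 2}" by (simp only: bij_betw_def)
  then have perm: "\<sigma> permutes {1..2 * n + 2}"
    by (rule bij_imp_permutes) (simp only: \<sigma>_def if_True not_False_eq_True)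
  have \<sigma>_row: "\<sigma> (row_position n i) = v i" if "i \<in> {1..2 * n}" for i
    using \<sigma>_v[OF row_position_mem[OF that]] position_row_row_position[OF that] by simp
  have even_less: "\<sigma> (2 * i) < 2 * i" if "i \<in> {1..n + 1}" for i
  proof (cases "i = 1")
    case False
    then have i: "i - 1 \<in> {1..2 * n}" "2 * i = row_position n (i - 1)"
      using that by (auto simp: row_position_def)
    have "v (i - 1) \<le> 2 * c (i - 1) + 1" by (simp add: v_def)
    also have "\<dots> < 2 * i" using c_le[OF i(1)] False that by auto
    finally show ?thesis using \<sigma>_row[OF i(1)] i(2) by simp
  qed (simp add: \<sigma>_ends)
  have odd_greater: "2 * i - 1 < \<sigma> (2 * i - 1)" if "i \<in> {1..n + 1}" for i
  proof (cases "i = n + 1")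
    case False
    then have i: "i + n \<in> {1..2 * n}" "2 * i - 1 = row_position n (i + n)"
      using that by (auto simp: row_position_def)
    have "2 * i - 1 < 2 * c (i + n)" using le_c[OF i(1)] that by auto
    also have "\<dots> \<le> v (i + n)" by (simp add: v_def)
    finally show ?thesis using \<sigma>_row[OF i(1)] i(2) by simp
  qed (use \<sigma>_ends in simp)
  have norm: "(even (inv \<sigma> (2 * j)) \<longleftrightarrow> even (inv \<sigma> (2 * j + 1))) \<longleftrightarrow>
      inv \<sigma> (2 * j) > inv \<sigma> (2 * j + 1)" if j: "j \<in> {1..n}" for j
  proof -
    obtain a b where "{i. (j, i) \<in> C} = {a, b}" "a \<noteq> b"
      using column[OF j] by (auto simp: card_2_iff)
    then obtain i k where ik: "(j, i) \<in> C" "(j, k) \<in> C" "i < k"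
      by (metis insertCI linorder_neqE_nat mem_Collect_eq)
    then have mem: "i \<in> {1..2 * n}" "k \<in> {1..2 * n}" using sub by auto
    then have "c i = j" "c k = j" using c ik by auto
    then have "\<sigma> (row_position n i) = 2 * j + 1" "\<sigma> (row_position n k) = 2 * j"
      using v_decreasing[OF mem ik(3)] \<sigma>_row mem by auto
    then have "inv \<sigma> (2 * j + 1) = row_position n i" "inv \<sigma> (2 * j) = row_position n k"
      using permutes_inv_eq[OF perm] by auto
    \<comment> \<open>On the same side, the upper row k has the later position and carries 2j, so
      both sides of the equivalence hold. On opposite sides, these bounds place k before i while the
      parities differ, so both fail.\<close>
    moreover have "j \<le> i" "k \<le> j + n" using bound ik by auto
    ultimately show ?thesis
      using mem ik(3) by (auto simp: row_position_def)
  qed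
  have "\<sigma> \<in> normalized_dumont_perms (n + 1)"
    using perm even_less odd_greater norm
    by (auto simp: normalized_dumont_perms_def dumont_perms_def)
  moreover have "dellac_of n \<sigma> = C"
  proof -
    have "dellac_of n \<sigma> = (\<lambda>i. (c i, i)) ` {1..2 * n}"
      unfolding dellac_of_def
      by (rule image_cong) (auto simp: row_column_def row_value_def \<sigma>_row v_div)
    also have "\<dots> = C" using c sub by auto
    finally show ?thesis .
  qed
  ultimately show ?thesis by blast
qed

lemma bij_betw_dellac_of:
  "bij_betw (dellac_of n) (normalized_dumont_perms (n + 1)) (dellac_configs n)"
  unfolding bij_betw_def
  using dellac_of_inj dellac_of_surj normalized_dumont.dellac_of_mem
  by (fastforce simp: normalized_dumont_def)

theorem theorem5:
  fixes n :: nat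
  assumes "n \<ge> 1"
  shows "\<exists>\<phi>. bij_betw \<phi> (dellac_configs n) (normalized_dumont_perms (n + 1)) \<and>
    (\<forall>C\<in>dellac_configs n. dumont_st (n + 1) (\<phi> C) = int (n choose 2) - int (dellac_inv C))"
proof (intro exI conjI ballI)
  \<comment> \<open>The construction runs from permutations to configurations, so its inverse is the
    map sought.\<close>
  let ?\<phi> = "inv_into (normalized_dumont_perms (n + 1)) (dellac_of n)"
  show bij: "bij_betw ?\<phi> (dellac_configs n) (normalized_dumont_perms (n + 1))"
    by (rule bij_betw_inv_into) (rule bij_betw_dellac_of)
  fix C assume C: "C \<in> dellac_configs n"
  then have "normalized_dumont n (?\<phi> C)"
    using bij_betw_apply[OF bij] by (simp add: normalized_dumont_def)
  moreover have "dellac_of n (?\<phi> C) = C"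
    using bij_betw_dellac_of C by (rule bij_betw_inv_into_right)
  ultimately show "dumont_st (n + 1) (?\<phi> C) = int (n choose 2) - int (dellac_inv C)"
    using normalized_dumont.dumont_st_eq by fastforce
qed

end
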